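(* Let $\mathcal{X}\subset\mathbb{R}$ be countably infinite and let $(\mathcal{Y}_x)_{x\in\mathcal{X}}$ be an independent family of random closed subsets of $\mathbb{R}$ with $P[\mathcal{Y}_x=\emptyset]=0$ for all $x\in\mathcal{X}$. Let $D_x(0):=\inf\{|y|: y\in\mathcal{Y}_x\}$ and let $B$ be the event that there exists a bounded function $f:\mathbb{R}\to\mathbb{R}$ with $f(x)\in\mathcal{Y}_x$ for all $x\in\mathcal{X}$. If $$\sup_{x\in\mathcal{X}}D_x(0)<\infty\quad\text{almost surely},$$ then $P[B]=1$; otherwise $P[B]=0$.
   Context: All random objects are defined on a complete probability space $(\Omega,\mathcal{F},P)$. A random closed set is a random variable with values in the space of closed subsets of $\mathbb{R}$, equipped with the Borel $\sigma$-algebra generated by the Fell topology. Convention: $\inf\emptyset=\infty$. That $B\in\mathcal{F}$ is part of the assertion. *)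

theory Defs
  imports "HOL-Probability.Probability"
begin

text \<open>
  Subbase of the Fell topology: the closed sets that miss a given compact set, and the closed
  sets that hit a given open set. Taking the empty compact set shows that the topology lives on
  all closed sets, including the empty one.
\<close>

definition fell_topology :: "'a::topological_space set topology" where
  "fell_topology = topology_generated_by
     ({{F. closed F \<and> F \<inter> K = {}} | K. compact K} \<union> {{F. closed F \<and> F \<inter> G \<noteq> {}} | G. open G})"

definition fell_borel :: "'a::topological_space set measure" where
  "fell_borel = sigma (topspace fell_topology) {\<U>. openin fell_topology \<U>}"

lemma topspace_fell_topology: "topspace fell_topology = {F :: 'a::topological_space set. closed F}"
  (is "_ = ?C")
proof -
  let ?S = "{{F :: 'a set. closed F \<and> F \<inter> K = {}} | K. compact K} \<union>
    {{F :: 'a set. closed F \<and> F \<inter> G \<noteq> {}} | G. open G}"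
  have 1: "\<Union>?S \<subseteq> ?C"
  proof (rule Union_least)
    fix U assume "U \<in> ?S"
    then show "U \<subseteq> ?C"
      by (elim UnE CollectE exE conjE) (simp_all add: subset_iff)
  qed
  have "?C \<in> ?S"
    by (intro UnI1 CollectI exI[of _ "{}"]) simp
  then have 2: "?C \<subseteq> \<Union>?S"
    by (rule Union_upper)
  from 1 2 have "\<Union>?S = ?C"
    by (rule equalityI)
  then show ?thesis
    unfolding fell_topology_def topology_generated_by_topspace .
qed

lemma space_fell_borel: "space fell_borel = {F. closed F}"
  by (simp add: fell_borel_def space_measure_of_conv topspace_fell_topology)

lemma sets_fell_borel: "sets fell_borel = sigma_sets {F. closed F} {\<U>. openin fell_topology \<U>}"
proof -
  have "{\<U>. openin fell_topology \<U>} \<subseteq> Pow (topspace fell_topology)"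
    by (intro subsetI PowI) (meson CollectD openin_subset subsetD)
  then show ?thesis
    unfolding fell_borel_def topspace_fell_topology by (rule sets_measure_of)
qed

text \<open>The infimum is taken in the extended reals, so that it is infinite for the empty set.\<close>

definition dist_origin :: "real set \<Rightarrow> ereal" where
  "dist_origin F = (INF y\<in>F. ereal \<bar>y\<bar>)"

lemma dist_origin_empty: "dist_origin {} = \<infinity>"
  by (simp add: dist_origin_def top_ereal_def)

definition bounded_selection_event ::
  "'w measure \<Rightarrow> real set \<Rightarrow> (real \<Rightarrow> 'w \<Rightarrow> real set) \<Rightarrow> 'w set" where
  "bounded_selection_event M X Y =
     {\<omega> \<in> space M. \<exists>f :: real \<Rightarrow> real. bounded (range f) \<and> (\<forall>x\<in>X. f x \<in> Y x \<omega>)}"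

end

theory Submission
  imports Defs
begin

text \<open>
  A bounded selection exists exactly when the distances of the sets to the origin have finite
  supremum. Along an enumeration of the index set, a supremum is finite iff every term is finite
  and the limit superior is finite. The distances are almost surely finite, and finiteness of the
  limit superior is a tail event, so Kolmogorov's zero-one law applies.
\<close>

lemma dist_origin_less_iff: "dist_origin F < c \<longleftrightarrow> (\<exists>y\<in>F. ereal \<bar>y\<bar> < c)"
  by (simp add: dist_origin_def INF_less_iff)

lemma dist_origin_eq_infinity_iff: "dist_origin F = \<infinity> \<longleftrightarrow> F = {}"
  using dist_origin_less_iff[of F \<infinity>] by auto

text \<open>The distance to the origin is below \<open>c\<close> exactly when the set hits the open
  set \<open>?G\<close>, and hitting an open set is a subbasic event of the Fell topology.\<close>

lemma measurable_dist_origin [measurable]: "dist_origin \<in> borel_measurable fell_borel"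
proof (rule borel_measurableI_less)
  fix c :: ereal
  let ?G = "{y :: real. ereal \<bar>y\<bar> < c}"
  have "open ?G"
    by (intro open_Collect_less continuous_intros)
  then have "openin fell_topology {F. closed F \<and> F \<inter> ?G \<noteq> {}}"
    unfolding fell_topology_def by (intro topology_generated_by_Basis) blast
  moreover have "{F \<in> space fell_borel. dist_origin F < c} = {F. closed F \<and> F \<inter> ?G \<noteq> {}}"
    by (auto simp: space_fell_borel dist_origin_less_iff)
  ultimately show "{F \<in> space fell_borel. dist_origin F < c} \<in> sets fell_borel"
    by (simp add: sets_fell_borel sigma_sets.Basic)
qed

text \<open>A real \<open>c\<close> strictly above the supremum leaves room to pick in each set a
  point of modulus below \<open>c\<close>, so it does not matter whether the infimum is
  attained.\<close>

lemma bounded_selection_iff: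
  "(\<exists>f :: real \<Rightarrow> real. bounded (range f) \<and> (\<forall>x\<in>X. f x \<in> S x))
    \<longleftrightarrow> (SUP x\<in>X. dist_origin (S x)) < \<infinity>"
proof
  assume "\<exists>f :: real \<Rightarrow> real. bounded (range f) \<and> (\<forall>x\<in>X. f x \<in> S x)"
  then obtain f c where "\<And>x. \<bar>f x\<bar> \<le> c" "\<And>x. x \<in> X \<Longrightarrow> f x \<in> S x"
    by (auto simp: bounded_iff)
  then have "(SUP x\<in>X. dist_origin (S x)) \<le> ereal c"
    unfolding dist_origin_def by (intro SUP_least) (auto intro!: INF_lower2)
  then show "(SUP x\<in>X. dist_origin (S x)) < \<infinity>"
    using le_less_trans less_ereal.simps(4) by blast
next
  assume "(SUP x\<in>X. dist_origin (S x)) < \<infinity>"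
  then obtain c :: real where "(SUP x\<in>X. dist_origin (S x)) < ereal c"
    using ereal_dense2 by blast
  then have "dist_origin (S x) < ereal c" if "x \<in> X" for x
    using that by (meson SUP_lessD)
  then have "\<forall>x\<in>X. \<exists>y\<in>S x. \<bar>y\<bar> < c"
    by (simp add: dist_origin_less_iff)
  then obtain g where g: "\<And>x. x \<in> X \<Longrightarrow> g x \<in> S x \<and> \<bar>g x\<bar> < c"
    by metis
  \<comment> \<open>The value 0 off \<open>X\<close> keeps the range bounded on the whole
    line.\<close>
  define f where "f x = (if x \<in> X then g x else 0)" for x
  \<comment> \<open>The bound is \<open>\<bar>c\<bar>\<close> because \<open>c\<close> may be
    negative when \<open>X\<close> is empty, and the default value 0 must be covered too.\<close>
  have "bounded (range f)"
    unfolding bounded_iff using g by (intro exI[of _ "\<bar>c\<bar>"]) (force simp: f_def)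
  then show "\<exists>f :: real \<Rightarrow> real. bounded (range f) \<and> (\<forall>x\<in>X. f x \<in> S x)"
    using g by (intro exI[of _ f]) (auto simp: f_def)
qed

lemma SUP_less_infinity_iff:
  fixes u :: "nat \<Rightarrow> ereal"
  shows "(SUP n. u n) < \<infinity> \<longleftrightarrow> (\<forall>n. u n < \<infinity>) \<and> limsup u < \<infinity>"
proof (intro iffI conjI allI)
  assume *: "(SUP n. u n) < \<infinity>"
  show "u n < \<infinity>" for n
    using * by (meson SUP_lessD UNIV_I)
  show "limsup u < \<infinity>"
    using * by (rule le_less_trans[rotated]) (auto intro!: Limsup_bounded always_eventually SUP_upper)
next
  assume *: "(\<forall>n. u n < \<infinity>) \<and> limsup u < \<infinity>"
  \<comment> \<open>The limit superior is the infimum of the suprema over tails, so some tail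
    already has a supremum below infinity. Only the finitely many terms before \<open>m\<close>
    remain.\<close>
  then obtain m where m: "(SUP n\<in>{m..}. u n) < \<infinity>"
    unfolding limsup_INF_SUP INF_less_iff by blast
  have "(SUP n\<in>{..<m}. u n) < \<infinity>"
    using * by (induction m) (auto simp: lessThan_Suc bot_ereal_def sup_max max_def)
  moreover have "(SUP n. u n) = sup (SUP n\<in>{..<m}. u n) (SUP n\<in>{m..}. u n)"
  proof -
    have "UNIV = {..<m} \<union> {m..}"
      by auto
    then show ?thesis
      by (metis SUP_union)
  qed
  ultimately show "(SUP n. u n) < \<infinity>"
    using m by (simp add: sup_max max_def)
qed

context prob_space
begin

text \<open>Carries independence from the index set of reals to the natural numbers, where
  Kolmogorov's law applies.\<close>

lemma indep_vars_reindex_inj: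
  assumes "indep_vars N Z (f ` I)" "inj_on f I"
  shows "indep_vars (\<lambda>i. N (f i)) (\<lambda>i. Z (f i)) I"
  unfolding indep_vars_def2
proof (intro conjI ballI indep_setsI)
  show "random_variable (N (f i)) (Z (f i))" if "i \<in> I" for i
    using assms(1) that by (auto simp: indep_vars_def2)
  then show "{Z (f i) -` A \<inter> space M | A. A \<in> sets (N (f i))} \<subseteq> events" if "i \<in> I" for i
    using that by (auto intro: measurable_sets)
  fix A J
  assume J: "J \<noteq> {}" "J \<subseteq> I" "finite J"
    and A: "\<forall>j\<in>J. A j \<in> {Z (f j) -` A \<inter> space M | A. A \<in> sets (N (f j))}"
  let ?g = "the_inv_into J f"
  have inj: "inj_on f J"
    using assms(2) J(2) inj_on_subset by blast
  then have g: "?g (f j) = j" if "j \<in> J" for j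
    using that by (simp add: the_inv_into_f_f)
  have "prob (\<Inter>x\<in>f ` J. A (?g x)) = (\<Prod>x\<in>f ` J. prob (A (?g x)))"
    using assms(1) J A g unfolding indep_vars_def2
    by (intro indep_setsD[of _ "f ` I"]) auto
  then show "prob (\<Inter>j\<in>J. A j) = (\<Prod>j\<in>J. prob (A j))"
    using g by (simp add: prod.reindex[OF inj])
qed

text \<open>Dropping the first \<open>k\<close> terms leaves the limit superior unchanged, so the
  event is determined by the variables from index \<open>k\<close> on, for every
  \<open>k\<close>.\<close>

lemma limsup_less_0_1_law:
  fixes D :: "nat \<Rightarrow> 'a \<Rightarrow> ereal"
  assumes "indep_vars (\<lambda>_. borel) D UNIV"
  shows "prob {\<omega> \<in> space M. limsup (\<lambda>n. D n \<omega>) < c} \<in> {0, 1}"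
proof -
  let ?A = "\<lambda>i. sigma_sets (space M) {D i -` B \<inter> space M | B. B \<in> sets borel}"
  let ?T = "{\<omega> \<in> space M. limsup (\<lambda>n. D n \<omega>) < c}"
  have "?T \<in> tail_events ?A"
    unfolding tail_events_def
  proof
    fix k
    \<comment> \<open>The sample space with only the information from index \<open>k\<close> on; the
      shifted variables are measurable for it, hence so is their limit superior.\<close>
    let ?N = "sigma (space M) (\<Union>i\<in>{k..}. ?A i)"
    have sub: "(\<Union>i\<in>{k..}. ?A i) \<subseteq> Pow (space M)"
      using sigma_sets_into_sp[of "{D _ -` B \<inter> space M | B. B \<in> sets borel}" "space M"] by blast
    have [measurable]: "D (n + k) \<in> borel_measurable ?N" for n
    proof (rule measurableI)
      fix B :: "ereal set" assume "B \<in> sets borel"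
      then have "D (n + k) -` B \<inter> space M \<in> ?A (n + k)"
        by blast
      then show "D (n + k) -` B \<inter> space ?N \<in> sets ?N"
        using sub by (simp add: sets_measure_of space_measure_of_conv)
          (rule sigma_sets.Basic, auto)
    qed simp
    have "{\<omega> \<in> space ?N. limsup (\<lambda>n. D (n + k) \<omega>) < c} \<in> sets ?N"
      by measurable
    then show "?T \<in> sigma_sets (space M) (\<Union>i\<in>{k..}. ?A i)"
      using sub by (simp add: limsup_shift_k[of "\<lambda>n. D n _" k] sets_measure_of space_measure_of_conv)
  qed
  moreover have "sigma_algebra (space M) (?A i)" for i
    by (intro sigma_algebra_sigma_sets) auto
  moreover have "indep_sets ?A UNIV"
    using assms by (simp add: indep_vars_def)
  ultimately show ?thesis
    using kolmogorov_0_1_law[of ?A ?T] by blast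
qed

end

theorem proposition3:
  fixes M :: "'w measure" and X :: "real set" and Y :: "real \<Rightarrow> 'w \<Rightarrow> real set"
  assumes "prob_space M" and "complete_measure M"
    and "countable X" and "infinite X"
    and "\<And>x. x \<in> X \<Longrightarrow> Y x \<in> M \<rightarrow>\<^sub>M fell_borel"
    and "prob_space.indep_vars M (\<lambda>_. fell_borel) Y X"
    and "\<And>x. x \<in> X \<Longrightarrow> measure M {\<omega> \<in> space M. Y x \<omega> = {}} = 0"
  shows "bounded_selection_event M X Y \<in> sets M \<and>
    ((AE \<omega> in M. (SUP x\<in>X. dist_origin (Y x \<omega>)) < \<infinity>)
      \<longrightarrow> measure M (bounded_selection_event M X Y) = 1) \<and>
    (\<not> (AE \<omega> in M. (SUP x\<in>X. dist_origin (Y x \<omega>)) < \<infinity>)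
      \<longrightarrow> measure M (bounded_selection_event M X Y) = 0)"
proof -
  interpret prob_space M by fact
  let ?e = "from_nat_into X"
  define D where "D n \<omega> = dist_origin (Y (?e n) \<omega>)" for n \<omega>
  have e: "bij_betw ?e UNIV X"
    using assms(3,4) by (rule bij_betw_from_nat_into)
  then have range_e: "range ?e = X" and e_in: "?e n \<in> X" for n
    by (auto simp: bij_betw_def)
  have [measurable]: "Y (?e n) \<in> M \<rightarrow>\<^sub>M fell_borel" for n
    using assms(5) e_in .
  have [measurable]: "D n \<in> borel_measurable M" for n
    unfolding D_def by measurable
  have SUP_eq: "(SUP x\<in>X. dist_origin (Y x \<omega>)) = (SUP n. D n \<omega>)" for \<omega>
  proof -
    have "(SUP n. D n \<omega>) = (SUP x\<in>range ?e. dist_origin (Y x \<omega>))"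
      by (simp only: D_def image_image)
    then show ?thesis
      by (simp only: range_e)
  qed
  let ?B = "bounded_selection_event M X Y"
  have B_eq: "?B = {\<omega> \<in> space M. (SUP n. D n \<omega>) < \<infinity>}"
    unfolding bounded_selection_event_def bounded_selection_iff SUP_eq ..
  have B: "?B \<in> events"
    unfolding B_eq by measurable
  \<comment> \<open>Finiteness of the supremum is not itself a tail event, since one empty set makes
    the supremum infinite. Nonemptiness almost surely removes this obstacle.\<close>
  have "AE \<omega> in M. D n \<omega> < \<infinity>" for n
  proof -
    have eq: "{\<omega> \<in> space M. Y (?e n) \<omega> = {}} = {\<omega> \<in> space M. D n \<omega> = \<infinity>}"
      by (simp add: D_def dist_origin_eq_infinity_iff)
    have "{\<omega> \<in> space M. D n \<omega> = \<infinity>} \<in> events"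
      by measurable
    then have "AE \<omega> in M. \<not> D n \<omega> = \<infinity>"
      using assms(7)[OF e_in[of n]] prob_eq_0[of "{\<omega> \<in> space M. D n \<omega> = \<infinity>}"]
      unfolding eq by auto
    then show ?thesis
      by eventually_elim auto
  qed
  then have "AE \<omega> in M. \<forall>n. D n \<omega> < \<infinity>"
    by (simp add: AE_all_countable)
  \<comment> \<open>Off a null set the selection event thus coincides with a tail event, so the two
    have the same probability.\<close>
  then have "AE \<omega> in M. (SUP n. D n \<omega>) < \<infinity> \<longleftrightarrow> limsup (\<lambda>n. D n \<omega>) < \<infinity>"
    by eventually_elim (simp only: SUP_less_infinity_iff simp_thms)
  then have "prob ?B = prob {\<omega> \<in> space M. limsup (\<lambda>n. D n \<omega>) < \<infinity>}"
    unfolding B_eq by (intro finite_measure_eq_AE) auto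
  moreover have "indep_vars (\<lambda>_. borel) D UNIV"
  proof -
    have "indep_vars (\<lambda>_. fell_borel) (\<lambda>n. Y (?e n)) UNIV"
      using assms(6) e indep_vars_reindex_inj[of "\<lambda>_. fell_borel" Y ?e UNIV]
      unfolding bij_betw_def by metis
    then show ?thesis
      unfolding D_def by (rule indep_vars_compose2) measurable
  qed
  ultimately have "prob ?B \<in> {0, 1}"
    using limsup_less_0_1_law by metis
  \<comment> \<open>With only 0 and 1 possible, this equivalence settles both cases: if the supremum
    is not almost surely finite, the value 1 is excluded.\<close>
  moreover have "prob ?B = 1 \<longleftrightarrow> (AE \<omega> in M. (SUP x\<in>X. dist_origin (Y x \<omega>)) < \<infinity>)"
    using B unfolding SUP_eq B_eq by (rule prob_Collect_eq_1)
  ultimately show ?thesis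
    using B by auto
qed

end
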